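(* Let $\mathbf{A}\in\mathbb{R}^{n\times n}$ and $\mathbf{b}\in\mathbb{R}^n$, with every column of $\mathbf{A}$ nonzero (so that all updates below are defined). The derivative-free penetrating gradient algorithm applied to the linear system $\mathbf{A}\mathbf{x}=\mathbf{b}$, with all coordinate axes taken as search directions in sequence, is equivalent to the Gauss-Seidel method applied to the system $\mathbf{A}^T\mathbf{A}\mathbf{x}=\mathbf{A}^T\mathbf{b}$: for every common starting point $\mathbf{x}^{(0)}\in\mathbb{R}^n$, the two methods produce identical sequences of successive values of the unknowns.
   Context: Derivative-free penetrating gradient algorithm for a linear system $\mathbf{A}\mathbf{x}=\mathbf{b}$: let $\mathbf{a}_j\in\mathbb{R}^n$ denote the $j$-th column of $\mathbf{A}$. Given the current point $\mathbf{x}=(x_1,\dots,x_n)$ and the $k$-th coordinate axis as search direction, keep all $x_j$, $j\ne k$, fixed at their current values and regard $x_k$ as an unknown $\lambda$; this turns the system into the linear system $\mathbf{a}_k\lambda=\mathbf{c}$ of $n$ equations in one unknown, with $\mathbf{c}=\mathbf{b}-\sum_{j\neq k}x_j\mathbf{a}_j$. If $\|\mathbf{a}_k\|\neq 0$, replace $x_k$ by the least squares solution $\lambda_{LS}=\mathbf{a}_k^T\mathbf{c}/\|\mathbf{a}_k\|^2$, leaving the other components unchanged; if $\|\mathbf{a}_k\|=0$, the update fails. "All axes taken in sequence" means that the updates are performed cyclically for $k=1,2,\dots,n,1,2,\dots,n,\dots$, each using the most recent values of all other components. Gauss-Seidel method for a system $\mathbf{C}\mathbf{y}=\mathbf{d}$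 with $\mathbf{C}=(c_{ij})\in\mathbb{R}^{n\times n}$, $\mathbf{d}\in\mathbb{R}^n$ and all $c_{kk}\neq0$: cyclically for $k=1,2,\dots,n,1,2,\dots$, replace $y_k$ by $\frac{1}{c_{kk}}\bigl(d_k-\sum_{j\ne k}c_{kj}y_j\bigr)$, using the most recent values of the other components. *)

theory Defs
  imports Complex_Main "Jordan_Normal_Form.Matrix"
begin

text \<open>Coordinates are numbered \<open>0, \<dots>, n - 1\<close> instead of \<open>1, \<dots>, n\<close>.\<close>

definition norm_vec :: "real vec \<Rightarrow> real" where
  "norm_vec v = sqrt (v \<bullet> v)"

definition least_squares :: "real vec \<Rightarrow> real vec \<Rightarrow> real" where
  "least_squares a c = (a \<bullet> c) / (norm_vec a)\<^sup>2"

text \<open>The formula above gives the unique minimiser of the residual of the \<open>n\<close> equations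
  \<open>l \<cdot>\<^sub>v a = c\<close> in the one unknown \<open>l\<close>.\<close>

lemma least_squares_minimises:
  assumes a: "a \<in> carrier_vec n" and c: "c \<in> carrier_vec n" and nz: "norm_vec a \<noteq> 0"
    and l: "l \<noteq> least_squares a c"
  shows "norm_vec (least_squares a c \<cdot>\<^sub>v a - c) < norm_vec (l \<cdot>\<^sub>v a - c)"
proof -
  have expand: "(m \<cdot>\<^sub>v a - c) \<bullet> (m \<cdot>\<^sub>v a - c) = m\<^sup>2 * (a \<bullet> a) - 2 * m * (a \<bullet> c) + c \<bullet> c" for m
    using a c unfolding scalar_prod_def
    by (simp add: sum_distrib_left algebra_simps power2_eq_square
        flip: sum.distrib sum_subtractf)
  have nonneg: "a \<bullet> a \<ge> 0"
    by (simp add: scalar_prod_def sum_nonneg)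
  have pos: "a \<bullet> a > 0"
    using nz nonneg by (auto simp: norm_vec_def)
  have m: "least_squares a c * (a \<bullet> a) = a \<bullet> c"
    using pos by (simp add: least_squares_def norm_vec_def)
  have "0 < (l - least_squares a c)\<^sup>2 * (a \<bullet> a)"
    using pos l by simp
  also have "\<dots> = l\<^sup>2 * (a \<bullet> a) - 2 * l * (least_squares a c * (a \<bullet> a))
      - (least_squares a c)\<^sup>2 * (a \<bullet> a) + 2 * least_squares a c * (least_squares a c * (a \<bullet> a))"
    by (simp add: algebra_simps power2_eq_square)
  finally show ?thesis
    unfolding norm_vec_def real_sqrt_less_iff expand m by simp
qed

text \<open>The right-hand side of the system in the single unknown \<open>x\<^sub>k\<close> that remains when all
  other components of \<open>x\<close> are kept fixed.\<close>

definition pg_rhs :: "real mat \<Rightarrow> real vec \<Rightarrow> nat \<Rightarrow> real vec \<Rightarrow> real vec" where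
  "pg_rhs A b k x =
     b - finsum_vec TYPE(real) (dim_row A) (\<lambda>j. x $ j \<cdot>\<^sub>v col A j) ({..<dim_col A} - {k})"

text \<open>\<open>None\<close> means that the update fails.\<close>

definition pg_step :: "real mat \<Rightarrow> real vec \<Rightarrow> nat \<Rightarrow> real vec \<Rightarrow> real vec option" where
  "pg_step A b k x =
     (if norm_vec (col A k) \<noteq> 0
      then Some (x |\<^sub>v k \<mapsto> least_squares (col A k) (pg_rhs A b k x))
      else None)"

text \<open>The index \<open>t\<close> counts single coordinate updates, not full sweeps.\<close>

fun pg_iter :: "real mat \<Rightarrow> real vec \<Rightarrow> real vec \<Rightarrow> nat \<Rightarrow> real vec option" where
  "pg_iter A b x0 0 = Some x0"
| "pg_iter A b x0 (Suc t) = Option.bind (pg_iter A b x0 t) (pg_step A b (t mod dim_col A))"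

definition gauss_seidel_step :: "real mat \<Rightarrow> real vec \<Rightarrow> nat \<Rightarrow> real vec \<Rightarrow> real vec" where
  "gauss_seidel_step C d k y =
     (y |\<^sub>v k \<mapsto> (1 / C $$ (k, k)) * (d $ k - (\<Sum>j\<in>{..<dim_col C} - {k}. C $$ (k, j) * y $ j)))"

text \<open>Only meaningful for \<open>C\<close> without zeros on the diagonal.\<close>

fun gauss_seidel_iter :: "real mat \<Rightarrow> real vec \<Rightarrow> real vec \<Rightarrow> nat \<Rightarrow> real vec" where
  "gauss_seidel_iter C d y0 0 = y0"
| "gauss_seidel_iter C d y0 (Suc t) =
     gauss_seidel_step C d (t mod dim_col C) (gauss_seidel_iter C d y0 t)"

end

theory Submission
  imports Defs
begin

lemma norm_vec_eq_0_iff: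
  assumes "v \<in> carrier_vec n"
  shows "norm_vec v = 0 \<longleftrightarrow> v = 0\<^sub>v n"
  using assms by (auto simp: norm_vec_def scalar_prod_def sum_nonneg_eq_0_iff)

lemma norm_vec_square: "(norm_vec v)\<^sup>2 = v \<bullet> v"
  by (simp add: norm_vec_def scalar_prod_def sum_nonneg)

text \<open>Linearity of the dot product in its second argument: in coordinates both sides are the
  same double sum. It serves to move the pairing with \<open>col A k\<close> inside the sum of fixed
  terms in \<open>pg_rhs\<close>.\<close>

lemma scalar_prod_finsum_vec:
  fixes f :: "'b \<Rightarrow> 'a::semiring_0 vec"
  assumes "finite S" and "u \<in> carrier_vec n" and "f \<in> S \<rightarrow> carrier_vec n"
  shows "u \<bullet> finsum_vec TYPE('a) n f S = (\<Sum>j\<in>S. u \<bullet> f j)"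
proof -
  \<comment> \<open>\<open>scalar_prod\<close> sums over the dimension of its second argument, so
    this fact fixes the index range as \<open>{..<n}\<close>.\<close>
  have fc: "finsum_vec TYPE('a) n f S \<in> carrier_vec n"
    using assms by (intro finsum_vec_closed) auto
  then have "u \<bullet> finsum_vec TYPE('a) n f S = (\<Sum>i<n. \<Sum>j\<in>S. u $ i * f j $ i)"
    using assms by (simp add: scalar_prod_def index_finsum_vec sum_distrib_left atLeast0LessThan)
  also have "\<dots> = (\<Sum>j\<in>S. u \<bullet> f j)"
    unfolding scalar_prod_def
    by (subst sum.swap, rule sum.cong) (use assms in \<open>auto simp: Pi_iff atLeast0LessThan\<close>)
  finally show ?thesis .
qed

text \<open>Pairing \<open>a\<^sub>k \<lambda> = c\<close> with \<open>a\<^sub>k\<close> gives row \<open>k\<close> of the normal equations, in which the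
  coefficient of \<open>x\<^sub>k\<close> is the squared norm of \<open>a\<^sub>k\<close>.\<close>

lemma least_squares_pg_rhs:
  assumes A: "A \<in> carrier_mat m n" and b: "b \<in> carrier_vec m" and k: "k < n"
  shows "least_squares (col A k) (pg_rhs A b k x) =
    (1 / (A\<^sup>T * A) $$ (k, k)) *
      ((A\<^sup>T *\<^sub>v b) $ k - (\<Sum>j\<in>{..<n} - {k}. (A\<^sup>T * A) $$ (k, j) * x $ j))"
proof -
  have "col A k \<bullet> pg_rhs A b k x =
      col A k \<bullet> b - (\<Sum>j\<in>{..<n} - {k}. col A k \<bullet> (x $ j \<cdot>\<^sub>v col A j))"
    unfolding pg_rhs_def using A b
    by (subst scalar_prod_minus_distrib[of _ m])
      (auto intro!: finsum_vec_closed simp: scalar_prod_finsum_vec)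
  \<comment> \<open>Row \<open>k\<close> of the transpose is column \<open>k\<close> of
    \<open>A\<close>, so every dot product with \<open>col A k\<close> is an entry of the Gram
    matrix or of the transformed right-hand side.\<close>
  also have "\<dots> = (A\<^sup>T *\<^sub>v b) $ k - (\<Sum>j\<in>{..<n} - {k}. (A\<^sup>T * A) $$ (k, j) * x $ j)"
    using A b k by (auto intro!: sum.cong simp: mult.commute)
  finally show ?thesis
    using A k by (simp add: least_squares_def norm_vec_square)
qed

text \<open>The nonzero column rules out the branch \<open>None\<close>; both methods then write the
  same number into position \<open>k\<close>.\<close>

lemma pg_step_eq_gauss_seidel_step:
  assumes "A \<in> carrier_mat m n" and "b \<in> carrier_vec m" and "k < n"
    and "col A k \<noteq> 0\<^sub>v m"
  shows "pg_step A b k x = Some (gauss_seidel_step (A\<^sup>T * A) (A\<^sup>T *\<^sub>v b) k x)"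
proof -
  have "norm_vec (col A k) \<noteq> 0"
    using assms norm_vec_eq_0_iff[of "col A k" m] by auto
  then show ?thesis
    using assms(1) least_squares_pg_rhs[OF assms(1-3)]
    by (simp add: pg_step_def gauss_seidel_step_def)
qed

text \<open>Division by zero yields 0 in HOL, so the first conjunct is what certifies that the
  Gauss-Seidel updates are genuine. The second follows by induction on single updates.\<close>

theorem mainTheorem3:
  fixes n :: nat and A :: "real mat" and b :: "real vec"
  assumes "n \<ge> 1"
    and "A \<in> carrier_mat n n"
    and "b \<in> carrier_vec n"
    and "\<And>k. k < n \<Longrightarrow> col A k \<noteq> 0\<^sub>v n"
  shows "(\<forall>k<n. (A\<^sup>T * A) $$ (k, k) \<noteq> 0) \<and>
    (\<forall>x0 \<in> carrier_vec n. \<forall>t.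
      pg_iter A b x0 t = Some (gauss_seidel_iter (A\<^sup>T * A) (A\<^sup>T *\<^sub>v b) x0 t))"
proof (intro conjI allI impI ballI)
  fix k assume k: "k < n"
  have "(A\<^sup>T * A) $$ (k, k) = (norm_vec (col A k))\<^sup>2"
    using assms(2) k by (simp add: norm_vec_square)
  then show "(A\<^sup>T * A) $$ (k, k) \<noteq> 0"
    using assms(2) assms(4)[OF k] norm_vec_eq_0_iff[of "col A k" n] by auto
next
  fix x0 :: "real vec" and t
  show "pg_iter A b x0 t = Some (gauss_seidel_iter (A\<^sup>T * A) (A\<^sup>T *\<^sub>v b) x0 t)"
  proof (induction t)
    case (Suc t)
    \<comment> \<open>Here \<open>n \<ge> 1\<close> matters, since \<open>t mod 0 = t\<close>. Both
      iterations pick this index, as \<open>A\<close> and \<open>A\<^sup>T * A\<close> both have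
      \<open>n\<close> columns.\<close>
    have "t mod n < n"
      using assms(1) by simp
    from pg_step_eq_gauss_seidel_step[OF assms(2,3) this assms(4)[OF this]]
    show ?case
      using Suc assms(2) by simp
  qed simp
qed

end
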